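(* Let $G$ be a graph on $n$ vertices and let $k$ be an integer with $1\le k\le n-1$. Suppose that $v_1,\dots,v_s$ ($s\ge 2$) are pendant vertices of $G$ all adjacent to a common vertex $v$ with $d_G(v)\ne n-1$. Let $G^+$ be a graph obtained from $G$ by adding any $t$ edges ($0\le t\le s(s-1)/2$) among $v_1,\dots,v_s$. If $\alpha(F_k(G))=\alpha(G)$, then $\alpha(F_k(G^+))=\alpha(G^+)$.
   Context: $\alpha(G)$ denotes the algebraic connectivity of $G$, i.e. the second smallest eigenvalue of its Laplacian matrix. For a graph $G=(V,E)$ on $n$ vertices and $1\le k\le n-1$, the $k$-token graph $F_k(G)$ has as vertices the $k$-subsets of $V$, two $k$-subsets being adjacent iff their symmetric difference is $\{a,b\}$ with $ab\in E$. A pendant vertex is a vertex of degree 1; $d_G(v)$ is the degree of $v$. *)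

theory Defs
  imports "Jordan_Normal_Form.Char_Poly"
begin

definition simple_graph :: "'a set \<Rightarrow> 'a set set \<Rightarrow> bool" where
  "simple_graph V E \<longleftrightarrow> finite V \<and> (\<forall>e\<in>E. e \<subseteq> V \<and> card e = 2)"

definition vertex_degree :: "'a set set \<Rightarrow> 'a \<Rightarrow> nat" where
  "vertex_degree E v = card {e \<in> E. v \<in> e}"

definition pendant :: "'a set set \<Rightarrow> 'a \<Rightarrow> bool" where
  "pendant E v \<longleftrightarrow> vertex_degree E v = 1"

definition laplacian_mat :: "'a list \<Rightarrow> 'a set set \<Rightarrow> real mat" where
  "laplacian_mat vs E = mat (length vs) (length vs) (\<lambda>(i, j).
     if i = j then real (vertex_degree E (vs ! i))
     else if {vs ! i, vs ! j} \<in> E then -1 else 0)"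

text \<open>Rows and columns are ordered by an arbitrary enumeration of the vertices;
  lemma \<open>char_poly_laplacian_mat_cong\<close> below shows that the choice is immaterial.\<close>

definition laplacian_char_poly :: "'a set \<Rightarrow> 'a set set \<Rightarrow> real poly" where
  "laplacian_char_poly V E =
     char_poly (laplacian_mat (SOME vs. distinct vs \<and> set vs = V) E)"

text \<open>Eigenvalues are listed in increasing order and with multiplicity, so index 1 is the
  second smallest one (and it is 0 for a disconnected graph). The matrix is real symmetric,
  so no eigenvalue is lost by taking real roots. The value is meaningful only for
  graphs with at least two vertices.\<close>

definition algebraic_connectivity :: "'a set \<Rightarrow> 'a set set \<Rightarrow> real" where
  "algebraic_connectivity V E =
     sorted_list_of_multiset (proots (laplacian_char_poly V E)) ! 1"

definition token_verts :: "nat \<Rightarrow> 'a set \<Rightarrow> 'a set set" where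
  "token_verts k V = {A. A \<subseteq> V \<and> card A = k}"

definition token_edges :: "nat \<Rightarrow> 'a set \<Rightarrow> 'a set set \<Rightarrow> 'a set set set" where
  "token_edges k V E = {{A, B} | A B. A \<in> token_verts k V \<and> B \<in> token_verts k V \<and>
     (\<exists>a b. sym_diff A B = {a, b} \<and> {a, b} \<in> E)}"

lemma simple_graph_token:
  assumes "simple_graph V E"
  shows "simple_graph (token_verts k V) (token_edges k V E)"
proof -
  have "A \<noteq> B" if "sym_diff A B \<in> E" for A B
    using that assms by (auto simp: simple_graph_def)
  then show ?thesis
    using assms by (auto simp: simple_graph_def token_verts_def token_edges_def card_2_iff)
qed

lemma char_poly_laplacian_mat_cong:
  assumes vs: "distinct vs" and ws: "distinct ws" and eq: "set vs = set ws"
  shows "char_poly (laplacian_mat vs E) = char_poly (laplacian_mat ws E)"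
proof -
  define n where "n = length vs"
  have n: "length vs = n" "length ws = n"
    using vs ws eq by (metis n_def distinct_card)+
  define f where "f i = (THE j. j < n \<and> ws ! j = vs ! i)" for i
  have "\<exists>!j. j < n \<and> ws ! j = vs ! i" if "i < n" for i
    using that n vs ws eq by (metis in_set_conv_nth nth_eq_iff_index_eq)
  from theI'[OF this] have f: "f i < n" "ws ! f i = vs ! i" if "i < n" for i
    using that by (auto simp: f_def)
  have inj: "f i = f j \<longleftrightarrow> i = j" if "i < n" "j < n" for i j
    using f[of i] f[of j] that vs n by (metis nth_eq_iff_index_eq)
  let ?P = "mat n n (\<lambda>(i, j). if j = f i then 1 else 0) :: real mat"
  let ?Q = "mat n n (\<lambda>(i, j). if i = f j then 1 else 0) :: real mat"
  let ?A = "laplacian_mat vs E" and ?B = "laplacian_mat ws E"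
  have PQ: "?P * ?Q = 1\<^sub>m n"
    using f inj by (intro eq_matI) (auto simp: scalar_prod_def if_distrib[of "\<lambda>x. x * _"] sum.delta cong: if_cong)
  have QP: "?Q * ?P = 1\<^sub>m n"
    by (rule mat_mult_left_right_inverse[OF _ _ PQ]) auto
  have PB: "?P * ?B = mat n n (\<lambda>(i, j). ?B $$ (f i, j))"
    using f n by (intro eq_matI)
      (auto simp: scalar_prod_def laplacian_mat_def if_distrib[of "\<lambda>x. x * _"] sum.delta cong: if_cong)
  have "?P * ?B * ?Q = mat n n (\<lambda>(i, j). ?B $$ (f i, f j))"
    unfolding PB using f n by (intro eq_matI)
      (auto simp: scalar_prod_def if_distrib[of "\<lambda>x. _ * x"] sum.delta cong: if_cong)
  also have "\<dots> = ?A"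
    using f n inj by (intro eq_matI) (auto simp: laplacian_mat_def)
  finally have "?A = ?P * ?B * ?Q" by simp
  then have "similar_mat ?A ?B"
    by (intro similar_matI[OF _ PQ QP]) (auto simp: laplacian_mat_def n)
  then show ?thesis by (rule char_poly_similar)
qed

lemma laplacian_char_poly_eq:
  assumes "distinct vs" "set vs = V"
  shows "laplacian_char_poly V E = char_poly (laplacian_mat vs E)"
proof -
  have "distinct (SOME vs. distinct vs \<and> set vs = V) \<and> set (SOME vs. distinct vs \<and> set vs = V) = V"
    using assms by (intro someI[of "\<lambda>vs. distinct vs \<and> set vs = V"]) auto
  then show ?thesis
    unfolding laplacian_char_poly_def using assms by (intro char_poly_laplacian_mat_cong) auto
qed

end

theory Submission
  imports Defs "Jordan_Normal_Form.Schur_Decomposition"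
begin

text \<open>
  The algebraic connectivity is the minimum of the Rayleigh quotient of the Laplacian over
  functions with zero sum, so it can only grow when edges are added. If \<open>x\<close> is an
  eigenfunction of \<open>G\<close>, then \<open>A \<mapsto> (\<Sum>a\<in>A. x a)\<close> is an eigenfunction of
  \<open>F\<^sub>k(G)\<close> for the same eigenvalue; hence \<open>\<alpha>(F\<^sub>k(G)) \<le> \<alpha>(G)\<close> for every graph.
  Since \<open>v\<close> has a pendant neighbour but is not adjacent to all other vertices,
  \<open>\<alpha>(G) < 1\<close>. The eigenvalue equation at a pendant neighbour \<open>u\<close> of \<open>v\<close> reads
  \<open>(1 - \<alpha>(G)) x u = x v\<close>, so an eigenfunction for \<open>\<alpha>(G)\<close> takes the same value at all
  these \<open>u\<close>, and edges among them do not change its Rayleigh quotient. Therefore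
  \<open>\<alpha>(G\<^sup>+) \<le> \<alpha>(G) = \<alpha>(F\<^sub>k(G)) \<le> \<alpha>(F\<^sub>k(G\<^sup>+)) \<le> \<alpha>(G\<^sup>+)\<close>.
\<close>

section \<open>Diagonalization of real symmetric matrices\<close>

text \<open>Complete \<open>v\<close> to a basis and apply Gram-Schmidt, which keeps the first
  vector; the normalized results are the columns.\<close>

lemma orthogonal_mat_with_first_col:
  fixes v :: "real vec"
  assumes v: "v \<in> carrier_vec n" and unit: "v \<bullet> v = 1"
  shows "\<exists>W \<in> carrier_mat n n. W\<^sup>T * W = 1\<^sub>m n \<and> W * W\<^sup>T = 1\<^sub>m n \<and> col W 0 = v"
proof -
  interpret cof_vec_space n "TYPE(real)" .
  have v0: "v \<noteq> 0\<^sub>v n" using unit by auto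
  define b where "b = basis_completion v"
  define ws where "ws = gram_schmidt n b"
  from basis_completion[OF v v0, folded b_def]
  have dist_b: "distinct b" and indep: "\<not> lin_dep (set b)" and b: "set b \<subseteq> carrier_vec n"
    and hdb: "hd b = v" and len_b: "length b = n" by auto
  have n: "n \<noteq> 0" using v0 v by (auto intro: ccontr)
  from hdb len_b n obtain vs where bv: "b = v # vs" by (cases b, auto)
  from gram_schmidt_result[OF b dist_b indep refl, folded ws_def]
  have ws: "set ws \<subseteq> carrier_vec n" "corthogonal ws" "length ws = n" by (auto simp: len_b)
  have "hd ws = v" using gram_schmidt_hd[OF v, of vs, folded bv] unfolding ws_def .
  then have ws0: "ws ! 0 = v" using ws(3) n by (metis hd_conv_nth list.size(3))
  have wsi: "ws ! i \<in> carrier_vec n" if "i < n" for i using ws that by auto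
  \<comment> \<open>\<open>gram_schmidt\<close> orthogonalizes without normalizing, hence the
    division by the norms. Column 0 stays \<open>v\<close> because \<open>v\<close> is already a
    unit vector.\<close>
  define W where "W = mat n n (\<lambda>(i, j). ws ! j $ i / sqrt (ws ! j \<bullet> ws ! j))"
  have W: "W \<in> carrier_mat n n" by (simp add: W_def)
  have "(W\<^sup>T * W) $$ (i, j) = (1\<^sub>m n) $$ (i, j)" if ij: "i < n" "j < n" for i j
  proof -
    have "(W\<^sup>T * W) $$ (i, j)
      = (ws ! i \<bullet> ws ! j) / (sqrt (ws ! i \<bullet> ws ! i) * sqrt (ws ! j \<bullet> ws ! j))"
      using ij wsi[OF ij(1)] wsi[OF ij(2)]
      by (auto simp: W_def scalar_prod_def sum_divide_distrib)
    moreover have "ws ! i \<bullet> ws ! j = 0 \<longleftrightarrow> i \<noteq> j"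
      using corthogonalD[OF ws(2), of i j] ij ws(3) by simp
    moreover have "ws ! i \<bullet> ws ! i \<ge> 0" by (auto simp: scalar_prod_def intro: sum_nonneg)
    ultimately show ?thesis using ij by (cases "i = j") auto
  qed
  then have WW: "W\<^sup>T * W = 1\<^sub>m n" using W by (intro eq_matI) auto
  have "W * W\<^sup>T = 1\<^sub>m n" by (rule mat_mult_left_right_inverse[OF _ W WW]) (use W in auto)
  moreover have "col W 0 = v"
    using n v by (intro eq_vecI) (auto simp: W_def ws0 unit)
  ultimately show ?thesis using W WW by blast
qed

text \<open>Deflation, by induction on the list of roots: a unit eigenvector becomes the first
  column of an orthogonal \<open>W\<close>, and conjugation by \<open>W\<close> splits off a 1 by 1
  block. The diagonal follows the order of the given list, so a sorted list can be supplied
  later.\<close>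

lemma real_symmetric_spectral:
  fixes A :: "real mat"
  assumes "A \<in> carrier_mat n n" and "A\<^sup>T = A" and "char_poly A = (\<Prod>e\<leftarrow>es. [:- e, 1:])"
  shows "\<exists>P. similar_mat_wit A (mat_diag n ((!) es)) P P\<^sup>T"
  using assms
proof (induction es arbitrary: n A)
  case Nil
  then have "n = 0" using degree_monic_char_poly[of A n] by simp
  then have "similar_mat_wit A (mat_diag n ((!) [])) (1\<^sub>m 0) (1\<^sub>m 0)\<^sup>T"
    using Nil.prems(1) by (intro similar_mat_witI[of _ _ 0]) (auto intro!: eq_matI)
  then show ?case by blast
next
  case (Cons e es n A)
  note A = Cons.prems(1) and sym = Cons.prems(2)
  define m where "m = n - 1"
  have cp: "char_poly A = [:- e, 1:] * (\<Prod>e\<leftarrow>es. [:- e, 1:])" using Cons.prems(3) by simp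
  have "eigenvalue A e" unfolding eigenvalue_root_char_poly[OF A] cp by simp
  then obtain u where u: "u \<in> carrier_vec n" "u \<noteq> 0\<^sub>v n" "A *\<^sub>v u = e \<cdot>\<^sub>v u"
    using A unfolding eigenvalue_def eigenvector_def by auto
  have n: "n = Suc m" using u(1,2) by (cases n) (auto simp: m_def)
  have upos: "u \<bullet> u > 0"
    using conjugate_square_greater_0_vec[OF u(1)] u(2) by simp
  define v where "v = (1 / sqrt (u \<bullet> u)) \<cdot>\<^sub>v u"
  have v: "v \<in> carrier_vec n" "v \<bullet> v = 1" "A *\<^sub>v v = e \<cdot>\<^sub>v v"
    using u upos A by (auto simp: v_def mult_mat_vec smult_smult_assoc mult.commute)
  obtain W where W: "W \<in> carrier_mat n n" and WW: "W\<^sup>T * W = 1\<^sub>m n" "W * W\<^sup>T = 1\<^sub>m n"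
    and col0: "col W 0 = v"
    using orthogonal_mat_with_first_col[OF v(1,2)] by blast
  define A' where "A' = W\<^sup>T * A * W"
  have WT: "W\<^sup>T \<in> carrier_mat n n" using W by simp
  have A': "A' \<in> carrier_mat n n" using W A by (simp add: A'_def)
  have sym': "A'\<^sup>T = A'"
    unfolding A'_def using W A WT
    by (simp add: transpose_mult[of _ n n _ n] sym assoc_mult_mat[of _ n n _ n _ n])
  have wit: "similar_mat_wit A' A W\<^sup>T W"
    by (rule similar_mat_witI[OF WW(1) WW(2) A'_def A' A WT W])
  \<comment> \<open>Column 0 of \<open>A'\<close> is \<open>W\<^sup>T\<close> applied to
    \<open>e\<close> times column 0 of \<open>W\<close>, so orthonormality of the columns leaves
    only the corner entry. Symmetry then clears row 0 as well.\<close>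
  have A'0: "A' $$ (i, 0) = (if i = 0 then e else 0)" if "i < n" for i
  proof -
    have "A' $$ (i, 0) = (W\<^sup>T * (A * W)) $$ (i, 0)"
      using W A WT by (simp add: A'_def assoc_mult_mat[of _ n n _ n _ n])
    also have "\<dots> = col W i \<bullet> (A *\<^sub>v v)"
      using W A that n by (simp add: col0[symmetric] mult_mat_vec_def)
    also have "\<dots> = e * (W\<^sup>T * W) $$ (i, 0)"
      using W that n v(1) by (simp add: v(3) col0)
    finally show ?thesis using that n WW(1) by simp
  qed
  have A'0': "A' $$ (0, i) = (if i = 0 then e else 0)" if "i < n" for i
    using A'0[OF that] sym' A' that n
    by (metis carrier_matD index_transpose_mat(1) zero_less_Suc)
  define B where "B = mat m m (\<lambda>(i, j). A' $$ (Suc i, Suc j))"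
  define a where "a = mat 1 1 (\<lambda>_. e)"
  have a: "a \<in> carrier_mat 1 1" and B: "B \<in> carrier_mat m m" by (auto simp: a_def B_def)
  have block: "A' = four_block_mat a (0\<^sub>m 1 m) (0\<^sub>m m 1) B"
    using A' n A'0 A'0' by (intro eq_matI) (auto simp: a_def B_def)
  have symB: "B\<^sup>T = B"
  proof (intro eq_matI)
    fix i j assume "i < dim_row B" "j < dim_col B"
    then have ij: "i < m" "j < m" using B by auto
    then have "A' $$ (Suc j, Suc i) = A'\<^sup>T $$ (Suc i, Suc j)" using A' n by simp
    then show "B\<^sup>T $$ (i, j) = B $$ (i, j)" using ij sym' by (simp add: B_def)
  qed (auto simp: B_def)
  have "char_poly A' = char_poly A"
    using wit char_poly_similar unfolding similar_mat_def by blast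
  moreover have "char_poly A' = char_poly a * char_poly B"
    unfolding block by (rule char_poly_four_block_zeros_col[OF a _ B]) simp
  moreover have "char_poly a = [:- e, 1:]"
    by (simp add: a_def char_poly_defs det_def sign_def)
  \<comment> \<open>Characteristic polynomials multiply over the diagonal blocks, and the linear
    factor of \<open>e\<close> cancels.\<close>
  ultimately have "char_poly B = (\<Prod>e\<leftarrow>es. [:- e, 1:])"
    using cp by (metis mult_cancel_left pCons_eq_0_iff zero_neq_one)
  from Cons.IH[OF B symB this]
  obtain R where R: "similar_mat_wit B (mat_diag m ((!) es)) R R\<^sup>T" by blast
  have Rc: "R \<in> carrier_mat m m" using similar_mat_witD2[OF B R] by simp
  let ?R = "four_block_mat (1\<^sub>m 1) (0\<^sub>m 1 m) (0\<^sub>m m 1) R"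
  have "similar_mat_wit A' (four_block_mat a (0\<^sub>m 1 m) (0\<^sub>m m 1) (mat_diag m ((!) es)))
     ?R (four_block_mat (1\<^sub>m 1) (0\<^sub>m 1 m) (0\<^sub>m m 1) R\<^sup>T)"
    unfolding block
    by (rule similar_mat_wit_four_block[OF similar_mat_wit_refl[OF a] R _ _ a B])
      (use Rc in auto)
  moreover have "four_block_mat a (0\<^sub>m 1 m) (0\<^sub>m m 1) (mat_diag m ((!) es)) = mat_diag n ((!) (e # es))"
    using n by (intro eq_matI) (auto simp: a_def mat_diag_def nth_Cons')
  moreover have "four_block_mat (1\<^sub>m 1) (0\<^sub>m 1 m) (0\<^sub>m m 1) R\<^sup>T = ?R\<^sup>T"
    using Rc by (subst transpose_four_block_mat[of _ 1 1 _ m _ m]) auto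
  ultimately have "similar_mat_wit A' (mat_diag n ((!) (e # es))) ?R ?R\<^sup>T" by simp
  from similar_mat_wit_trans[OF similar_mat_wit_sym[OF wit] this]
  have "similar_mat_wit A (mat_diag n ((!) (e # es))) (W * ?R) (?R\<^sup>T * W\<^sup>T)" .
  moreover have "?R\<^sup>T * W\<^sup>T = (W * ?R)\<^sup>T"
    using W Rc n by (subst transpose_mult[of _ n n _ n]) auto
  ultimately show ?case by metis
qed

text \<open>The Hermitian form of a real symmetric matrix takes real values, and at an eigenvector
  it equals \<open>z\<close> times a positive real number.\<close>

lemma real_symmetric_eigenvalue_real:
  fixes A :: "real mat"
  assumes A: "A \<in> carrier_mat n n" and sym: "A\<^sup>T = A"
    and ev: "eigenvalue (map_mat complex_of_real A) z"
  shows "z \<in> \<real>"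
proof -
  let ?A = "map_mat complex_of_real A"
  obtain v where v: "v \<in> carrier_vec n" "v \<noteq> 0\<^sub>v n" "?A *\<^sub>v v = z \<cdot>\<^sub>v v"
    using A ev unfolding eigenvalue_def eigenvector_def by auto
  have symA: "A $$ (i, j) = A $$ (j, i)" if "i < n" "j < n" for i j
    using that sym A by (metis carrier_matD index_transpose_mat(1))
  have row: "(\<Sum>j<n. of_real (A $$ (i, j)) * v $ j) = z * v $ i" if "i < n" for i
    using arg_cong[OF v(3), of "\<lambda>w. w $ i"] A v(1) that
    by (simp add: scalar_prod_def lessThan_atLeast0)
  define q where "q = (\<Sum>i<n. cnj (v $ i) * (\<Sum>j<n. of_real (A $$ (i, j)) * v $ j))"
  have "cnj q = (\<Sum>i<n. \<Sum>j<n. v $ i * (of_real (A $$ (i, j)) * cnj (v $ j)))"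
    by (simp add: q_def sum_distrib_left)
  also have "\<dots> = (\<Sum>j<n. \<Sum>i<n. v $ i * (of_real (A $$ (i, j)) * cnj (v $ j)))"
    by (rule sum.swap)
  also have "\<dots> = q"
    by (auto simp: q_def sum_distrib_left symA mult_ac intro!: sum.cong)
  finally have q: "cnj q = q" .
  define r where "r = (\<Sum>i<n. (cmod (v $ i))\<^sup>2)"
  have "q = (\<Sum>i<n. z * of_real ((cmod (v $ i))\<^sup>2))"
    unfolding q_def complex_norm_square by (intro sum.cong refl) (simp add: row)
  then have qz: "q = z * of_real r"
    by (simp add: r_def sum_distrib_left)
  obtain i where i: "i < n" "v $ i \<noteq> 0" using v(1,2) by (metis eq_vecI carrier_vecD index_zero_vec)
  then have "r > 0"
    unfolding r_def by (intro sum_pos2[of _ i]) auto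
  with q qz have "cnj z = z" by simp
  then show ?thesis by (simp add: Reals_cnj_iff)
qed

text \<open>Over the complex numbers the polynomial splits. All its roots are real, so the
  factorization is the image of a real one, and embedding real polynomials into complex ones is
  injective.\<close>

lemma real_symmetric_char_poly_splits:
  fixes A :: "real mat"
  assumes A: "A \<in> carrier_mat n n" and sym: "A\<^sup>T = A"
  shows "\<exists>es. char_poly A = (\<Prod>e\<leftarrow>es. [:- e, 1:]) \<and> length es = n"
proof -
  interpret p: map_poly_inj_comm_ring_hom complex_of_real ..
  let ?A = "map_mat complex_of_real A"
  have cA: "?A \<in> carrier_mat n n" using A by simp
  obtain zs where zs: "char_poly ?A = (\<Prod>z\<leftarrow>zs. [:- z, 1:])" "length zs = n"
    using char_poly_factorized[OF cA] by blast
  have "z \<in> \<real>" if "z \<in> set zs" for z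
  proof -
    have "poly (char_poly ?A) z = 0" using that
      by (auto simp: zs(1) poly_prod_list o_def prod_list_zero_iff)
    then show ?thesis
      using real_symmetric_eigenvalue_real[OF A sym] eigenvalue_root_char_poly[OF cA] by blast
  qed
  then have re: "map (\<lambda>z. complex_of_real (Re z)) zs = zs"
    by (intro map_idI) simp
  have "map_poly complex_of_real (char_poly A) = char_poly ?A"
    by (rule of_real_hom.char_poly_hom[OF A, symmetric])
  also have "\<dots> = (\<Prod>z\<leftarrow>map (\<lambda>z. complex_of_real (Re z)) zs. [:- z, 1:])"
    by (simp only: re zs(1))
  also have "\<dots> = map_poly complex_of_real (\<Prod>e\<leftarrow>map Re zs. [:- e, 1:])"
    by (simp add: p.hom_prod_list o_def)
  finally have "char_poly A = (\<Prod>e\<leftarrow>map Re zs. [:- e, 1:])"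
    by simp
  then show ?thesis using zs(2) by (intro exI[of _ "map Re zs"]) simp
qed

text \<open>Rayleigh principle on the orthogonal complement of a known kernel vector
  \<open>u\<close>. If \<open>es ! 1\<close> is positive, the kernel is the line through
  \<open>p 0\<close>, so being orthogonal to \<open>u\<close> means being orthogonal to
  \<open>p 0\<close>. If \<open>es ! 1\<close> is 0, the bound is just positive semidefiniteness,
  and the kernel is large enough to contain a nonzero vector orthogonal to \<open>u\<close>.\<close>

lemma symmetric_psd_second_eigenvalue:
  fixes A :: "real mat"
  assumes A: "A \<in> carrier_mat n n" and sym: "A\<^sup>T = A"
    and psd: "\<And>x. x \<in> carrier_vec n \<Longrightarrow> 0 \<le> x \<bullet> (A *\<^sub>v x)"
    and u: "u \<in> carrier_vec n" "u \<noteq> 0\<^sub>v n" "A *\<^sub>v u = 0\<^sub>v n"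
    and es: "char_poly A = (\<Prod>e\<leftarrow>es. [:- e, 1:])" "length es = n" "sorted es" and n: "2 \<le> n"
  shows "\<exists>x \<in> carrier_vec n. x \<noteq> 0\<^sub>v n \<and> x \<bullet> u = 0 \<and> A *\<^sub>v x = es ! 1 \<cdot>\<^sub>v x"
    and "\<And>x. x \<in> carrier_vec n \<Longrightarrow> x \<bullet> u = 0 \<Longrightarrow> es ! 1 * (x \<bullet> x) \<le> x \<bullet> (A *\<^sub>v x)"
proof -
  obtain P where wit: "similar_mat_wit A (mat_diag n ((!) es)) P P\<^sup>T"
    using real_symmetric_spectral[OF A sym es(1)] by blast
  let ?D = "mat_diag n ((!) es)"
  have P: "P \<in> carrier_mat n n" and PT: "P\<^sup>T \<in> carrier_mat n n"
    and PP: "P * P\<^sup>T = 1\<^sub>m n" "P\<^sup>T * P = 1\<^sub>m n" and APD: "A = P * ?D * P\<^sup>T"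
    using similar_mat_witD2[OF A wit] by blast+
  define p where "p i = col P i" for i
  have p: "p i \<in> carrier_vec n" for i using P by (auto simp: p_def)
  have ortho: "p i \<bullet> p j = (if i = j then 1 else 0)" if "i < n" "j < n" for i j
  proof -
    have "p i \<bullet> p j = (P\<^sup>T * P) $$ (i, j)" using that P by (simp add: p_def)
    then show ?thesis using that PP by simp
  qed
  have "A * P = P * ?D * (P\<^sup>T * P)"
    unfolding APD by (rule assoc_mult_mat[of _ n n _ n _ n]) (use P in auto)
  then have "A * P = P * ?D" using P PP by (simp add: right_mult_one_mat[of _ n n])
  then have AP: "A * P = mat n n (\<lambda>(i, j). P $$ (i, j) * es ! j)"
    using mat_diag_mult_right[OF P] by simp
  have ev: "A *\<^sub>v p i = es ! i \<cdot>\<^sub>v p i" if "i < n" for i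
  proof -
    have "A *\<^sub>v p i = col (A * P) i" using that A P by (simp add: p_def mult_mat_vec_def)
    also have "\<dots> = es ! i \<cdot>\<^sub>v p i"
      unfolding AP using that P by (intro eq_vecI) (auto simp: p_def)
    finally show ?thesis .
  qed
  have sa: "x \<bullet> (A *\<^sub>v y) = (A *\<^sub>v x) \<bullet> y" if "x \<in> carrier_vec n" "y \<in> carrier_vec n" for x y
    using transpose_vec_mult_scalar[OF A that(2,1)] sym by simp
  have pA: "p i \<bullet> (A *\<^sub>v x) = es ! i * (p i \<bullet> x)" if "i < n" "x \<in> carrier_vec n" for i x
    using sa[OF p that(2)] ev[OF that(1)] that p[of i] by simp
  have parseval: "x \<bullet> y = (\<Sum>i<n. (p i \<bullet> x) * (p i \<bullet> y))"
    if x: "x \<in> carrier_vec n" and y: "y \<in> carrier_vec n" for x y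
  proof -
    have "x \<bullet> y = x \<bullet> (P *\<^sub>v (P\<^sup>T *\<^sub>v y))"
      using P PT PP y by (simp flip: assoc_mult_mat_vec[of _ n n _ n])
    also have "\<dots> = (P\<^sup>T *\<^sub>v x) \<bullet> (P\<^sup>T *\<^sub>v y)"
      using transpose_vec_mult_scalar[OF P, of "P\<^sup>T *\<^sub>v y" x] x y PT by simp
    also have "\<dots> = (\<Sum>i<n. (p i \<bullet> x) * (p i \<bullet> y))"
      using P by (simp add: scalar_prod_def[of "P\<^sup>T *\<^sub>v x"] p_def lessThan_atLeast0)
    finally show ?thesis .
  qed
  have nonneg: "0 \<le> es ! i" if "i < n" for i
    using psd[OF p[of i]] pA[OF that p[of i]] ortho[OF that that] by simp
  \<comment> \<open>By symmetry, \<open>es ! i * (p i \<bullet> u)\<close> is the product of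
    \<open>p i\<close> with \<open>A *\<^sub>v u\<close>, which vanishes.\<close>
  have uorth: "p i \<bullet> u = 0" if "i < n" "es ! i \<noteq> 0" for i
    using pA[OF that(1) u(1)] u(3) that p[of i] by auto
  have upos: "u \<bullet> u > 0" using conjugate_square_greater_0_vec[OF u(1)] u(2) by simp
  have mono: "es ! i \<le> es ! j" if "i \<le> j" "j < n" for i j
    using sorted_nth_mono[OF es(3)] that es(2) by simp
  have pnz: "p i \<noteq> 0\<^sub>v n" if "i < n" for i using ortho[OF that that] by auto
  show "\<exists>x \<in> carrier_vec n. x \<noteq> 0\<^sub>v n \<and> x \<bullet> u = 0 \<and> A *\<^sub>v x = es ! 1 \<cdot>\<^sub>v x"
  proof (cases "es ! 1 = 0")
    case False
    then show ?thesis
      using uorth[of 1] ev[of 1] pnz[of 1] n p by (intro bexI[of _ "p 1"]) auto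
  next
    case True
    then have e0: "es ! 0 = 0" using mono[of 0 1] nonneg[of 0] n by simp
    show ?thesis
    proof (cases "p 0 \<bullet> u = 0")
      case True
      then show ?thesis
        using ev[of 0] pnz[of 0] n p e0 \<open>es ! 1 = 0\<close> by (intro bexI[of _ "p 0"]) auto
    next
      case False
      \<comment> \<open>Both \<open>p 0\<close> and \<open>p 1\<close> lie in the kernel here; the
        coefficients make the two products with \<open>u\<close> cancel. The component of
        \<open>x\<close> along \<open>p 1\<close> is minus \<open>p 0 \<bullet> u\<close>, which is
        nonzero in this case.\<close>
      define x where "x = (p 1 \<bullet> u) \<cdot>\<^sub>v p 0 - (p 0 \<bullet> u) \<cdot>\<^sub>v p 1"
      have x: "x \<in> carrier_vec n" using p by (simp add: x_def)
      have "x \<bullet> u = 0"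
        using p[of 0] p[of 1] u(1) unfolding x_def
        by (subst minus_scalar_prod_distrib[of _ n]) auto
      moreover have "x \<bullet> p 1 = - (p 0 \<bullet> u)"
        using p[of 0] p[of 1] ortho[of 0 1] ortho[of 1 1] n unfolding x_def
        by (subst minus_scalar_prod_distrib[of _ n]) auto
      then have "x \<noteq> 0\<^sub>v n" using False p[of 1] by auto
      moreover have "A *\<^sub>v x = es ! 1 \<cdot>\<^sub>v x"
      proof -
        have "A *\<^sub>v x = (p 1 \<bullet> u) \<cdot>\<^sub>v (A *\<^sub>v p 0) - (p 0 \<bullet> u) \<cdot>\<^sub>v (A *\<^sub>v p 1)"
          unfolding x_def using A p[of 0] p[of 1]
          by (subst mult_minus_distrib_mat_vec[of _ n n]) (auto simp: mult_mat_vec)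
        then show ?thesis
          using ev[of 0] ev[of 1] n e0 True x p[of 0] p[of 1] by (auto intro!: eq_vecI)
      qed
      ultimately show ?thesis using x by blast
    qed
  qed
  show "es ! 1 * (x \<bullet> x) \<le> x \<bullet> (A *\<^sub>v x)" if x: "x \<in> carrier_vec n" and xu: "x \<bullet> u = 0" for x
  proof (cases "es ! 1 = 0")
    case True
    then show ?thesis using psd[OF x] by simp
  next
    case False
    then have pos: "es ! 1 > 0" using nonneg[of 1] n by simp
    have pu: "p i \<bullet> u = 0" if "i < n" "i \<noteq> 0" for i
      using uorth[of i] mono[of 1 i] pos that by force
    \<comment> \<open>Only the term for \<open>p 0\<close> survives in either expansion. The first
      equation shows that \<open>p 0 \<bullet> u\<close> is nonzero, and the second then gives
      \<open>p 0 \<bullet> x = 0\<close>.\<close>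
    have "u \<bullet> u = (p 0 \<bullet> u) * (p 0 \<bullet> u)" and "x \<bullet> u = (p 0 \<bullet> x) * (p 0 \<bullet> u)"
      unfolding parseval[OF u(1) u(1)] parseval[OF x u(1)] using n pu
      by (subst sum.remove[of _ 0]; auto intro!: sum.neutral)+
    then have x0: "p 0 \<bullet> x = 0" using upos xu by auto
    have Ax: "A *\<^sub>v x \<in> carrier_vec n" using A x by simp
    have "es ! 1 * (x \<bullet> x) = (\<Sum>i<n. es ! 1 * ((p i \<bullet> x) * (p i \<bullet> x)))"
      by (simp add: parseval[OF x x] sum_distrib_left)
    also have "\<dots> \<le> (\<Sum>i<n. es ! i * ((p i \<bullet> x) * (p i \<bullet> x)))"
    proof (intro sum_mono)
      fix i assume "i \<in> {..<n}"
      then show "es ! 1 * ((p i \<bullet> x) * (p i \<bullet> x)) \<le> es ! i * ((p i \<bullet> x) * (p i \<bullet> x))"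
        using x0 mono[of 1 i] by (cases "i = 0") (auto intro: mult_right_mono)
    qed
    also have "\<dots> = x \<bullet> (A *\<^sub>v x)"
      unfolding parseval[OF x Ax] using x by (intro sum.cong) (auto simp: pA)
    finally show ?thesis .
  qed
qed

section \<open>Rayleigh quotients of graph Laplacians\<close>

text \<open>The Laplacian as an operator on functions on the vertices. It needs no enumeration, so
  it applies equally to \<open>V\<close> and to the vertex set of a token graph.\<close>

definition graph_laplacian :: "'a set \<Rightarrow> 'a set set \<Rightarrow> ('a \<Rightarrow> real) \<Rightarrow> 'a \<Rightarrow> real" where
  "graph_laplacian V E f a = (\<Sum>b \<in> {b\<in>V. {a, b} \<in> E}. f a - f b)"

lemma vertex_degree_eq_card_neighbours:
  assumes "simple_graph V E"
  shows "vertex_degree E a = card {b\<in>V. {a, b} \<in> E}"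
proof -
  have "{e \<in> E. a \<in> e} = (\<lambda>b. {a, b}) ` {b\<in>V. {a, b} \<in> E}"
  proof (intro equalityI subsetI)
    fix e assume "e \<in> {e \<in> E. a \<in> e}"
    moreover from this obtain x y where "e = {x, y}" "x \<in> V" "y \<in> V"
      using assms by (auto simp: simple_graph_def card_2_iff)
    ultimately show "e \<in> (\<lambda>b. {a, b}) ` {b\<in>V. {a, b} \<in> E}"
      by (auto simp: insert_commute)
  qed auto
  moreover have "inj_on (\<lambda>b. {a, b}) {b\<in>V. {a, b} \<in> E}"
    by (auto simp: inj_on_def doubleton_eq_iff)
  ultimately show ?thesis by (simp add: vertex_degree_def card_image)
qed

lemma not_loop: "simple_graph V E \<Longrightarrow> {a, b} \<in> E \<Longrightarrow> a \<noteq> b"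
  by (auto simp: simple_graph_def)

text \<open>Symmetrize the double sum by swapping \<open>a\<close> and \<open>b\<close>. The factor
  1/2 is there because each edge is met once in each direction.\<close>

lemma sum_f_graph_laplacian:
  assumes "finite V"
  shows "(\<Sum>a\<in>V. f a * graph_laplacian V E f a)
    = (\<Sum>a\<in>V. \<Sum>b\<in>V. if {a, b} \<in> E then (f a - f b)\<^sup>2 else 0) / 2"
proof -
  let ?h = "\<lambda>a b. if {a, b} \<in> E then f a * (f a - f b) else 0"
  have lap: "f a * graph_laplacian V E f a = (\<Sum>b\<in>V. ?h a b)" for a
    using assms by (auto simp: graph_laplacian_def sum_distrib_left sum.inter_filter intro!: sum.cong)
  have "2 * (\<Sum>a\<in>V. f a * graph_laplacian V E f a)
      = (\<Sum>a\<in>V. \<Sum>b\<in>V. ?h a b) + (\<Sum>b\<in>V. \<Sum>a\<in>V. ?h a b)"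
    by (simp add: lap sum.swap[of ?h V V])
  also have "\<dots> = (\<Sum>a\<in>V. \<Sum>b\<in>V. ?h a b + ?h b a)"
    by (simp only: sum.distrib)
  also have "\<dots> = (\<Sum>a\<in>V. \<Sum>b\<in>V. if {a, b} \<in> E then (f a - f b)\<^sup>2 else 0)"
    by (intro sum.cong refl) (auto simp: insert_commute power2_eq_square algebra_simps)
  finally show ?thesis by simp
qed

lemma laplacian_mat_mult_vec:
  assumes G: "simple_graph V E" and vs: "distinct vs" "set vs = V" and i: "i < length vs"
  shows "(laplacian_mat vs E *\<^sub>v vec (length vs) (\<lambda>j. f (vs ! j))) $ i = graph_laplacian V E f (vs ! i)"
proof -
  let ?n = "length vs" and ?a = "vs ! i"
  let ?N = "{b\<in>V. {?a, b} \<in> E}"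
  have fin: "finite V" using G by (simp add: simple_graph_def)
  have aV: "?a \<in> V" using i vs by auto
  have "(laplacian_mat vs E *\<^sub>v vec ?n (\<lambda>j. f (vs ! j))) $ i
     = (\<Sum>j<?n. (if i = j then real (vertex_degree E ?a) else if {?a, vs ! j} \<in> E then -1 else 0) * f (vs ! j))"
    using i by (simp add: laplacian_mat_def scalar_prod_def lessThan_atLeast0)
  also have "\<dots> = (\<Sum>j<?n. (if ?a = vs ! j then real (vertex_degree E ?a) else if {?a, vs ! j} \<in> E then -1 else 0) * f (vs ! j))"
    using vs i by (intro sum.cong) (auto simp: nth_eq_iff_index_eq)
  also have "\<dots> = (\<Sum>b\<in>V. (if ?a = b then real (vertex_degree E ?a) else if {?a, b} \<in> E then -1 else 0) * f b)"
    by (rule sum.reindex_bij_betw[OF bij_betw_nth[OF vs(1) refl vs(2)[symmetric]],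
        where g = "\<lambda>b. (if ?a = b then real (vertex_degree E ?a) else if {?a, b} \<in> E then -1 else 0) * f b"])
  also have "\<dots> = (\<Sum>b\<in>V. (if ?a = b then real (vertex_degree E ?a) * f b else 0) - (if {?a, b} \<in> E then f b else 0))"
    using not_loop[OF G] by (intro sum.cong) auto
  also have "\<dots> = real (card ?N) * f ?a - (\<Sum>b\<in>?N. f b)"
    using fin aV by (simp add: sum_subtractf sum.inter_filter vertex_degree_eq_card_neighbours[OF G])
  also have "\<dots> = graph_laplacian V E f ?a"
    by (simp add: graph_laplacian_def sum_subtractf)
  finally show ?thesis .
qed

text \<open>Translation of the matrix result to functions on \<open>V\<close>. The kernel vector is
  the constant function 1, so orthogonality to it becomes the condition of zero sum.\<close>

lemma algebraic_connectivity_Rayleigh: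
  assumes G: "simple_graph V E" and card: "2 \<le> card V"
  shows algebraic_connectivity_eigenfunction:
      "\<exists>f. (\<exists>a\<in>V. f a \<noteq> 0) \<and> (\<Sum>a\<in>V. f a) = 0
         \<and> (\<forall>a\<in>V. graph_laplacian V E f a = algebraic_connectivity V E * f a)"
    and algebraic_connectivity_le_Rayleigh:
      "\<And>f. (\<Sum>a\<in>V. f a) = 0 \<Longrightarrow>
        algebraic_connectivity V E * (\<Sum>a\<in>V. (f a)\<^sup>2) \<le> (\<Sum>a\<in>V. f a * graph_laplacian V E f a)"
proof -
  have fin: "finite V" using G by (simp add: simple_graph_def)
  obtain vs where vs: "distinct vs" "set vs = V" using finite_distinct_list[OF fin] by auto
  define n where "n = length vs"
  have n: "2 \<le> n" using card vs distinct_card by (fastforce simp: n_def)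
  define A where "A = laplacian_mat vs E"
  have A: "A \<in> carrier_mat n n" by (simp add: A_def laplacian_mat_def n_def)
  have sym: "A\<^sup>T = A"
    by (intro eq_matI) (auto simp: A_def laplacian_mat_def insert_commute)
  define \<phi> where "\<phi> f = vec n (\<lambda>j. f (vs ! j))" for f :: "'a \<Rightarrow> real"
  have \<phi>: "\<phi> f \<in> carrier_vec n" for f by (simp add: \<phi>_def)
  have A\<phi>: "A *\<^sub>v \<phi> f = \<phi> (graph_laplacian V E f)" for f
    using A laplacian_mat_mult_vec[OF G vs] by (intro eq_vecI) (auto simp: \<phi>_def A_def n_def)
  have inner: "\<phi> f \<bullet> \<phi> g = (\<Sum>a\<in>V. f a * g a)" for f g
    using sum.reindex_bij_betw[OF bij_betw_nth[OF vs(1) refl vs(2)[symmetric]], of "\<lambda>a. f a * g a"]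
    by (simp add: \<phi>_def scalar_prod_def n_def lessThan_atLeast0)
  have bij: "bij_betw ((!) vs) {..<n} V"
    using vs by (auto simp: n_def intro: bij_betw_nth)
  \<comment> \<open>The entry of a vector at position j is assigned to the vertex
    \<open>vs ! j\<close>, so every vector comes from a function on the vertices.\<close>
  have surj: "\<exists>f. x = \<phi> f" if "x \<in> carrier_vec n" for x
    using that inv_into_f_f[OF bij_betw_imp_inj_on[OF bij]]
    by (intro exI[of _ "\<lambda>a. x $ inv_into {..<n} ((!) vs) a"] eq_vecI) (auto simp: \<phi>_def)
  have \<phi>0: "\<phi> f = 0\<^sub>v n \<longleftrightarrow> (\<forall>a\<in>V. f a = 0)" for f
    unfolding vs(2)[symmetric] by (auto simp: \<phi>_def vec_eq_iff all_set_conv_all_nth n_def)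
  have psd: "0 \<le> x \<bullet> (A *\<^sub>v x)" if x: "x \<in> carrier_vec n" for x
  proof -
    obtain f where "x = \<phi> f" using surj[OF x] by blast
    then show ?thesis
      by (simp add: A\<phi> inner sum_f_graph_laplacian[OF fin] sum_nonneg)
  qed
  define u where "u = \<phi> (\<lambda>_. 1)"
  have u: "u \<in> carrier_vec n" "u \<noteq> 0\<^sub>v n" "A *\<^sub>v u = 0\<^sub>v n"
    using \<phi> A\<phi>[of "\<lambda>_. 1"] card by (auto simp: u_def \<phi>0 graph_laplacian_def)
  obtain ds where ds: "char_poly A = (\<Prod>e\<leftarrow>ds. [:- e, 1:])" "length ds = n"
    using real_symmetric_char_poly_splits[OF A sym] by blast
  define es where "es = sort ds"
  have "(\<Prod>e\<leftarrow>ds. [:- e, 1:]) = (\<Prod>e\<leftarrow>es. [:- e, 1:])"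
    by (metis es_def mset_map mset_sort prod_mset_prod_list)
  then have es: "char_poly A = (\<Prod>e\<leftarrow>es. [:- e, 1:])" "length es = n" "sorted es"
    using ds by (auto simp: es_def)
  \<comment> \<open>The roots with multiplicity are exactly the list entries. Hence
    \<open>es\<close>, being sorted, is the list in the definition of algebraic connectivity, and
    its index 1 is the required eigenvalue.\<close>
  have "proots (\<Prod>e\<leftarrow>xs. [:- e, 1:]) = mset xs" for xs :: "real list"
  proof (induction xs)
    case (Cons x xs)
    have "(\<Prod>e\<leftarrow>xs. [:- e, 1:]) \<noteq> 0" by (auto simp: prod_list_zero_iff)
    then have "proots (\<Prod>e\<leftarrow>x # xs. [:- e, 1:]) = proots [:- x, 1:] + proots (\<Prod>e\<leftarrow>xs. [:- e, 1:])"
      unfolding list.map prod_list.Cons by (intro proots_mult) simp_all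
    then show ?case unfolding Cons.IH proots_linear_factor by simp
  qed simp
  then have "proots (laplacian_char_poly V E) = mset es"
    using laplacian_char_poly_eq[OF vs] es(1) by (simp add: A_def)
  then have \<alpha>: "algebraic_connectivity V E = es ! 1"
    using es(3) by (simp add: algebraic_connectivity_def sorted_sort_id)
  note main = symmetric_psd_second_eigenvalue[OF A sym psd u es n, folded \<alpha>]
  obtain x where x: "x \<in> carrier_vec n" "x \<noteq> 0\<^sub>v n" "x \<bullet> u = 0"
    "A *\<^sub>v x = algebraic_connectivity V E \<cdot>\<^sub>v x"
    using main(1) by blast
  obtain f where f: "x = \<phi> f" using surj[OF x(1)] by blast
  have "\<phi> (\<lambda>a. graph_laplacian V E f a - algebraic_connectivity V E * f a) = 0\<^sub>v n"
    using x(4) unfolding f A\<phi> by (auto simp: \<phi>_def vec_eq_iff)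
  then have "\<forall>a\<in>V. graph_laplacian V E f a = algebraic_connectivity V E * f a"
    by (simp add: \<phi>0)
  then show "\<exists>f. (\<exists>a\<in>V. f a \<noteq> 0) \<and> (\<Sum>a\<in>V. f a) = 0
         \<and> (\<forall>a\<in>V. graph_laplacian V E f a = algebraic_connectivity V E * f a)"
    using x(2,3) by (intro exI[of _ f]) (auto simp: f \<phi>0 u_def inner)
  show "algebraic_connectivity V E * (\<Sum>a\<in>V. (f a)\<^sup>2) \<le> (\<Sum>a\<in>V. f a * graph_laplacian V E f a)"
    if "(\<Sum>a\<in>V. f a) = 0" for f
    using main(2)[OF _ \<phi>[of f]] that by (simp add: u_def inner A\<phi> power2_eq_square)
qed

text \<open>A test function certifies by itself that the graph is large enough for a second
  eigenvalue to exist.\<close>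

lemma two_le_card_if_sum_eq_0:
  fixes f :: "'a \<Rightarrow> real"
  assumes "finite V" "a \<in> V" "f a \<noteq> 0" "(\<Sum>a\<in>V. f a) = 0"
  shows "2 \<le> card V"
proof (rule ccontr)
  assume "\<not> 2 \<le> card V"
  moreover have "card V \<noteq> 0" using assms by auto
  ultimately have "card V = 1" by simp
  then have "V = {a}" using assms(2) by (auto simp: card_1_singleton_iff)
  then show False using assms by simp
qed

lemma algebraic_connectivity_le:
  assumes G: "simple_graph V E" and a: "a \<in> V" "f a \<noteq> 0" and sum: "(\<Sum>a\<in>V. f a) = 0"
    and le: "(\<Sum>a\<in>V. f a * graph_laplacian V E f a) \<le> \<mu> * (\<Sum>a\<in>V. (f a)\<^sup>2)"
  shows "algebraic_connectivity V E \<le> \<mu>"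
proof -
  have fin: "finite V" using G by (simp add: simple_graph_def)
  have "algebraic_connectivity V E * (\<Sum>a\<in>V. (f a)\<^sup>2) \<le> \<mu> * (\<Sum>a\<in>V. (f a)\<^sup>2)"
    using algebraic_connectivity_le_Rayleigh[OF G two_le_card_if_sum_eq_0[OF fin a sum] sum] le
    by linarith
  moreover have "(\<Sum>a\<in>V. (f a)\<^sup>2) > 0"
    using fin a by (intro sum_pos2[of _ a]) auto
  ultimately show ?thesis by simp
qed

text \<open>An eigenfunction of the larger graph serves as test function for the smaller one:
  dropping edges removes nonnegative squares from the quadratic form.\<close>

lemma algebraic_connectivity_mono:
  assumes G': "simple_graph V E'" and sub: "E \<subseteq> E'" and card: "2 \<le> card V"
  shows "algebraic_connectivity V E \<le> algebraic_connectivity V E'"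
proof -
  have fin: "finite V" and G: "simple_graph V E" using G' sub by (auto simp: simple_graph_def)
  obtain f a where f: "a \<in> V" "f a \<noteq> 0" "(\<Sum>a\<in>V. f a) = 0"
    and ev: "\<forall>a\<in>V. graph_laplacian V E' f a = algebraic_connectivity V E' * f a"
    using algebraic_connectivity_eigenfunction[OF G' card] by blast
  have "(\<Sum>a\<in>V. f a * graph_laplacian V E f a) \<le> (\<Sum>a\<in>V. f a * graph_laplacian V E' f a)"
    unfolding sum_f_graph_laplacian[OF fin]
    using sub by (intro divide_right_mono sum_mono) auto
  also have "\<dots> = algebraic_connectivity V E' * (\<Sum>a\<in>V. (f a)\<^sup>2)"
    unfolding sum_distrib_left using ev by (intro sum.cong) (auto simp: power2_eq_square)
  finally show ?thesis by (rule algebraic_connectivity_le[OF G f])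
qed

section \<open>Token graphs\<close>

text \<open>Sets of equal size whose symmetric difference has two elements differ by one element on
  each side, so an edge of the token graph moves one token along an edge of \<open>E\<close>. This
  directed form lets the neighbours of \<open>A\<close> be enumerated.\<close>

lemma token_edges_iff:
  assumes G: "simple_graph V E"
  shows "{A, B} \<in> token_edges k V E \<longleftrightarrow> A \<in> token_verts k V \<and> B \<in> token_verts k V \<and>
    (\<exists>a\<in>A. \<exists>b\<in>V - A. {a, b} \<in> E \<and> B = insert b (A - {a}))"
proof
  assume "{A, B} \<in> token_edges k V E"
  then obtain a b where AB: "A \<in> token_verts k V" "B \<in> token_verts k V"
    and ab: "sym_diff A B = {a, b}" "{a, b} \<in> E"
  proof -
    obtain A' B' a b where "{A, B} = {A', B'}" and AB': "A' \<in> token_verts k V" "B' \<in> token_verts k V"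
      and ab: "sym_diff A' B' = {a, b}" "{a, b} \<in> E"
      using \<open>{A, B} \<in> token_edges k V E\<close> unfolding token_edges_def mem_Collect_eq
      by (elim exE conjE)
    then consider "A = A'" "B = B'" | "A = B'" "B = A'" by (auto simp: doubleton_eq_iff)
    then show ?thesis
    proof cases
      case 1
      then show ?thesis using that[of a b] AB' ab by simp
    next
      case 2
      then show ?thesis using that[of a b] AB' ab by (simp add: Un_commute)
    qed
  qed
  have fin: "finite A" "finite B"
    using AB G by (auto simp: token_verts_def simple_graph_def intro: finite_subset)
  \<comment> \<open>The two differences have equal size because \<open>A\<close> and
    \<open>B\<close> do, and their sizes add up to 2, so each is a singleton.\<close>
  have "card (A - B) + card (A \<inter> B) = card (B - A) + card (A \<inter> B)"
    using AB card_Int_Diff[OF fin(1), of B] card_Int_Diff[OF fin(2), of A]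
    by (simp add: token_verts_def Int_commute)
  moreover have "card (A - B) + card (B - A) = card {a, b}"
    unfolding ab(1)[symmetric] using fin by (intro card_Un_disjoint[symmetric]) auto
  moreover have "card {a, b} = 2" using not_loop[OF G ab(2)] by simp
  ultimately have "card (A - B) = 1" "card (B - A) = 1" by auto
  then obtain c d where cd: "A - B = {c}" "B - A = {d}" by (auto simp: card_1_singleton_iff)
  have "{c, d} = sym_diff A B" unfolding cd by blast
  then have "{c, d} \<in> E" using ab by simp
  moreover have "B = insert d (A - {c})" "c \<in> A" "d \<in> B - A" using cd by blast+
  moreover from this have "d \<in> V - A" using AB(2) by (auto simp: token_verts_def)
  ultimately show "A \<in> token_verts k V \<and> B \<in> token_verts k V \<and>
    (\<exists>a\<in>A. \<exists>b\<in>V - A. {a, b} \<in> E \<and> B = insert b (A - {a}))" using AB by blast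
next
  assume "A \<in> token_verts k V \<and> B \<in> token_verts k V \<and>
    (\<exists>a\<in>A. \<exists>b\<in>V - A. {a, b} \<in> E \<and> B = insert b (A - {a}))"
  then obtain a b where AB: "A \<in> token_verts k V" "B \<in> token_verts k V"
    and "a \<in> A" "b \<in> V - A" "{a, b} \<in> E" "B = insert b (A - {a})" by blast
  moreover from this have "sym_diff A B = {a, b}" by blast
  ultimately show "{A, B} \<in> token_edges k V E" unfolding token_edges_def by blast
qed

lemma token_swap_mem:
  assumes "finite V" "A \<in> token_verts k V" "a \<in> A" "b \<in> V - A"
  shows "insert b (A - {a}) \<in> token_verts k V"
proof -
  have "finite A" using assms by (auto simp: token_verts_def intro: finite_subset)
  then have "card (insert b (A - {a})) = card A"
    using assms card_Suc_Diff1[of A a] by simp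
  then show ?thesis using assms by (auto simp: token_verts_def)
qed

text \<open>Moving a token from \<open>a\<close> to \<open>b\<close> changes the sum over
  \<open>A\<close> by \<open>f b - f a\<close>, so only edges leaving \<open>A\<close> contribute on
  the left. Edges inside \<open>A\<close> may be added on the right, since their contributions
  cancel in pairs.\<close>

lemma graph_laplacian_token:
  assumes G: "simple_graph V E" and A: "A \<in> token_verts k V"
  shows "graph_laplacian (token_verts k V) (token_edges k V E) (\<lambda>A. \<Sum>a\<in>A. f a) A
    = (\<Sum>a\<in>A. graph_laplacian V E f a)"
proof -
  have finV: "finite V" using G by (simp add: simple_graph_def)
  have AV: "A \<subseteq> V" and finA: "finite A"
    using A finV by (auto simp: token_verts_def intro: finite_subset)
  let ?I = "Sigma A (\<lambda>a. {b\<in>V - A. {a, b} \<in> E})"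
  let ?h = "\<lambda>(a, b). insert b (A - {a})"
  have nb: "{B \<in> token_verts k V. {A, B} \<in> token_edges k V E} = ?h ` ?I"
    unfolding token_edges_iff[OF G] using A token_swap_mem[OF finV A] by auto
  have inj: "inj_on ?h ?I"
  proof (rule inj_onI)
    fix p q assume p: "p \<in> ?I" and q: "q \<in> ?I" and eq: "?h p = ?h q"
    obtain a b c d where pq: "p = (a, b)" "q = (c, d)" by fastforce
    \<comment> \<open>The moved token and its target can be read off from the new set, so distinct
      moves lead to distinct neighbours.\<close>
    have "A - ?h p = {a}" "?h p - A = {b}" "A - ?h q = {c}" "?h q - A = {d}"
      using p q pq by auto
    then show "p = q" using eq pq by (metis singleton_inject)
  qed
  have step: "(\<Sum>x\<in>A. f x) - (\<Sum>x\<in>?h p. f x) = (case p of (a, b) \<Rightarrow> f a - f b)" if "p \<in> ?I" for p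
    using that finA by (auto simp: sum_diff1)
  have inside: "(\<Sum>a\<in>A. \<Sum>b\<in>{b\<in>A. {a, b} \<in> E}. f a - f b) = 0"
  proof -
    let ?g = "\<lambda>a b. if {a, b} \<in> E then f a - f b else 0"
    have "(\<Sum>a\<in>A. \<Sum>b\<in>A. ?g a b) = (\<Sum>b\<in>A. \<Sum>a\<in>A. ?g a b)" by (rule sum.swap)
    also have "\<dots> = (\<Sum>b\<in>A. \<Sum>a\<in>A. - ?g b a)"
      by (intro sum.cong refl) (auto simp: insert_commute)
    also have "\<dots> = - (\<Sum>a\<in>A. \<Sum>b\<in>A. ?g a b)" by (simp only: sum_negf)
    finally show ?thesis using finA by (simp add: sum.inter_filter)
  qed
  have split: "graph_laplacian V E f a
     = (\<Sum>b\<in>{b\<in>A. {a, b} \<in> E}. f a - f b) + (\<Sum>b\<in>{b\<in>V - A. {a, b} \<in> E}. f a - f b)" for a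
  proof -
    have "{b\<in>V. {a, b} \<in> E} = {b\<in>A. {a, b} \<in> E} \<union> {b\<in>V - A. {a, b} \<in> E}" using AV by auto
    then show ?thesis
      unfolding graph_laplacian_def using finV finA by (auto intro!: sum.union_disjoint)
  qed
  have "graph_laplacian (token_verts k V) (token_edges k V E) (\<lambda>A. \<Sum>a\<in>A. f a) A
      = (\<Sum>p\<in>?I. (\<Sum>x\<in>A. f x) - (\<Sum>x\<in>?h p. f x))"
    unfolding graph_laplacian_def nb sum.reindex[OF inj] by (simp add: o_def)
  also have "\<dots> = (\<Sum>(a, b)\<in>?I. f a - f b)"
    by (rule sum.cong[OF refl step])
  also have "\<dots> = (\<Sum>a\<in>A. \<Sum>b\<in>{b\<in>V - A. {a, b} \<in> E}. f a - f b)"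
    using finV finA by (intro sum.Sigma[symmetric]) auto
  also have "\<dots> = (\<Sum>a\<in>A. graph_laplacian V E f a)"
    using inside by (simp add: split sum.distrib)
  finally show ?thesis .
qed

lemma card_token_verts_containing:
  assumes "finite V" "a \<in> V" "1 \<le> k"
  shows "card {A \<in> token_verts k V. a \<in> A} = (card V - 1) choose (k - 1)"
proof -
  have "{A \<in> token_verts k V. a \<in> A} = insert a ` {B. B \<subseteq> V - {a} \<and> card B = k - 1}"
  proof (intro equalityI subsetI)
    fix A assume A: "A \<in> {A \<in> token_verts k V. a \<in> A}"
    then have "finite A" using assms(1) by (auto simp: token_verts_def intro: finite_subset)
    then have "A - {a} \<in> {B. B \<subseteq> V - {a} \<and> card B = k - 1}" "A = insert a (A - {a})"
      using A by (auto simp: token_verts_def)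
    then show "A \<in> insert a ` {B. B \<subseteq> V - {a} \<and> card B = k - 1}" by blast
  next
    fix A assume "A \<in> insert a ` {B. B \<subseteq> V - {a} \<and> card B = k - 1}"
    then obtain B where B: "A = insert a B" "B \<subseteq> V - {a}" "card B = k - 1" by auto
    moreover from this have "finite B" "a \<notin> B" using assms(1) by (auto intro: finite_subset)
    ultimately show "A \<in> {A \<in> token_verts k V. a \<in> A}"
      using assms by (auto simp: token_verts_def)
  qed
  moreover have "inj_on (insert a) {B. B \<subseteq> V - {a} \<and> card B = k - 1}"
    by (rule inj_onI) (auto simp: insert_ident subset_Diff_insert)
  ultimately show ?thesis using assms n_subsets[of "V - {a}" "k - 1"] by (simp add: card_image)
qed

text \<open>Double counting: every vertex lies in equally many \<open>k\<close>-subsets. Hence a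
  function with zero sum lifts to one with zero sum on the token graph.\<close>

lemma sum_token_verts:
  fixes f :: "'a \<Rightarrow> real"
  assumes "finite V" "1 \<le> k"
  shows "(\<Sum>A\<in>token_verts k V. \<Sum>a\<in>A. f a) = real ((card V - 1) choose (k - 1)) * (\<Sum>a\<in>V. f a)"
proof -
  have fin: "finite (token_verts k V)" using assms(1) by (simp add: token_verts_def)
  have "(\<Sum>A\<in>token_verts k V. \<Sum>a\<in>A. f a) = (\<Sum>A\<in>token_verts k V. \<Sum>a\<in>{a\<in>V. a \<in> A}. f a)"
    by (intro sum.cong) (auto simp: token_verts_def)
  also have "\<dots> = (\<Sum>a\<in>V. \<Sum>A\<in>{A \<in> token_verts k V. a \<in> A}. f a)"
    by (rule sum.swap_restrict[OF fin assms(1)])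
  also have "\<dots> = (\<Sum>a\<in>V. real ((card V - 1) choose (k - 1)) * f a)"
    using card_token_verts_containing[OF assms(1) _ assms(2)] by (intro sum.cong) auto
  finally show ?thesis by (simp add: sum_distrib_left)
qed

text \<open>Ensures that the lifted eigenfunction is not zero. If all \<open>k\<close>-sums
  vanished, exchanging one element of a \<open>k\<close>-set would show \<open>f\<close> to be
  constant, and a constant function with zero sum vanishes.\<close>

lemma token_sum_nonzero:
  fixes f :: "'a \<Rightarrow> real"
  assumes fin: "finite V" and k: "1 \<le> k" "k \<le> card V - 1"
    and a: "a \<in> V" "f a \<noteq> 0" and sum: "(\<Sum>a\<in>V. f a) = 0"
  shows "\<exists>A \<in> token_verts k V. (\<Sum>a\<in>A. f a) \<noteq> 0"
proof (rule ccontr)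
  assume "\<not> ?thesis"
  then have zero: "(\<Sum>a\<in>A. f a) = 0" if "A \<in> token_verts k V" for A using that by blast
  have "f b = f a" if b: "b \<in> V" "b \<noteq> a" for b
  proof -
    \<comment> \<open>\<open>C\<close> is the common part of two \<open>k\<close>-sets differing by
      exchanging \<open>a\<close> and \<open>b\<close>; the upper bound on \<open>k\<close> leaves
      room for it outside \<open>{a, b}\<close>.\<close>
    have "k - 1 \<le> card (V - {a, b})" using fin k a(1) b by (simp add: card_Diff_subset)
    then obtain C where C: "C \<subseteq> V - {a, b}" "card C = k - 1"
      by (meson obtain_subset_with_card_n)
    have "finite C" "a \<notin> C" "b \<notin> C" using C fin by (auto intro: finite_subset)
    then have "(\<Sum>x\<in>insert a C. f x) = 0" "(\<Sum>x\<in>insert b C. f x) = 0"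
      using C a(1) b k by (intro zero; auto simp: token_verts_def)+
    then show ?thesis using \<open>finite C\<close> \<open>a \<notin> C\<close> \<open>b \<notin> C\<close> by simp
  qed
  then have "(\<Sum>x\<in>V. f x) = (\<Sum>x\<in>V. f a)" by (intro sum.cong) auto
  then show False using sum a fin by auto
qed

lemma algebraic_connectivity_token_le:
  assumes G: "simple_graph V E" and k: "1 \<le> k" "k \<le> card V - 1"
  shows "2 \<le> card (token_verts k V)"
    and "algebraic_connectivity (token_verts k V) (token_edges k V E) \<le> algebraic_connectivity V E"
proof -
  let ?T = "token_verts k V"
  have fin: "finite V" and finT: "finite ?T"
    using G simple_graph_token[OF G, of k] by (auto simp: simple_graph_def)
  have card: "2 \<le> card V" using k by simp
  obtain f a where f: "a \<in> V" "f a \<noteq> 0" "(\<Sum>a\<in>V. f a) = 0"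
    and ev: "\<forall>a\<in>V. graph_laplacian V E f a = algebraic_connectivity V E * f a"
    using algebraic_connectivity_eigenfunction[OF G card] by blast
  define g where "g A = (\<Sum>a\<in>A. f a)" for A
  obtain A where A: "A \<in> ?T" "g A \<noteq> 0"
    using token_sum_nonzero[OF fin k f] by (auto simp: g_def)
  have sum: "(\<Sum>A\<in>?T. g A) = 0" using sum_token_verts[OF fin k(1), of f] f(3) by (simp add: g_def)
  show "2 \<le> card ?T" by (rule two_le_card_if_sum_eq_0[OF finT A sum])
  have "graph_laplacian ?T (token_edges k V E) g A = algebraic_connectivity V E * g A" if "A \<in> ?T" for A
    unfolding g_def graph_laplacian_token[OF G that] sum_distrib_left
    using that ev by (intro sum.cong) (auto simp: token_verts_def)
  then have "(\<Sum>A\<in>?T. g A * graph_laplacian ?T (token_edges k V E) g A)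
     = algebraic_connectivity V E * (\<Sum>A\<in>?T. (g A)\<^sup>2)"
    unfolding sum_distrib_left by (intro sum.cong) (auto simp: power2_eq_square)
  then show "algebraic_connectivity ?T (token_edges k V E) \<le> algebraic_connectivity V E"
    by (intro algebraic_connectivity_le[OF simple_graph_token[OF G] A sum]) simp
qed

section \<open>Edges among pendant vertices\<close>

lemma pendant_neighbours:
  assumes G: "simple_graph V E" and "pendant E u" "{u, v} \<in> E"
  shows "{b\<in>V. {u, b} \<in> E} = {v}"
proof -
  have "card {b\<in>V. {u, b} \<in> E} = 1"
    using assms by (simp add: pendant_def vertex_degree_eq_card_neighbours[OF G])
  moreover have "v \<in> {b\<in>V. {u, b} \<in> E}" using assms by (auto simp: simple_graph_def)
  ultimately show ?thesis by (metis card_1_singletonE singletonD)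
qed

text \<open>A test function is chosen for which \<open>f a * graph_laplacian V E f a\<close> is at
  most the square of \<open>f a\<close> at every vertex, with strict inequality at some vertex
  \<open>w\<close> not adjacent to \<open>v\<close>.\<close>

lemma algebraic_connectivity_less_1:
  assumes G: "simple_graph V E" and v: "v \<in> V" and deg: "vertex_degree E v \<noteq> card V - 1"
    and u: "pendant E u" "{u, v} \<in> E"
  shows "algebraic_connectivity V E < 1"
proof -
  have fin: "finite V" using G by (simp add: simple_graph_def)
  have uV: "u \<in> V" using G u(2) by (auto simp: simple_graph_def)
  have uv: "u \<noteq> v" using not_loop[OF G u(2)] .
  have Nu: "{b\<in>V. {u, b} \<in> E} = {v}" by (rule pendant_neighbours[OF G u])
  obtain w where w: "w \<in> V" "w \<noteq> v" "{w, v} \<notin> E"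
  proof -
    have "{b\<in>V. {v, b} \<in> E} \<noteq> V - {v}"
    proof
      assume "{b\<in>V. {v, b} \<in> E} = V - {v}"
      then show False using deg fin v vertex_degree_eq_card_neighbours[OF G, of v] by simp
    qed
    moreover have "{b\<in>V. {v, b} \<in> E} \<subseteq> V - {v}" using not_loop[OF G, of v] by blast
    ultimately obtain w where "w \<in> V" "w \<noteq> v" "{v, w} \<notin> E" by blast
    then show ?thesis using that[of w] by (simp add: insert_commute)
  qed
  define R where "R = V - {u, v}"
  \<comment> \<open>Removing \<open>v\<close> separates \<open>u\<close> from \<open>R\<close>;
    \<open>f\<close> is constant on both sides, vanishes at \<open>v\<close>, and the value at
    \<open>u\<close> balances the sum. Only edges at \<open>v\<close> contribute to its
    Laplacian.\<close>
  define f where "f a = (if a = u then real (card R) else if a = v then 0 else -1)" for a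
  have V: "V = insert u (insert v R)" "u \<notin> insert v R" "v \<notin> R" "finite R"
    using uV v uv fin by (auto simp: R_def)
  have sum: "(\<Sum>a\<in>V. f a) = 0"
  proof -
    have "(\<Sum>a\<in>R. f a) = (\<Sum>a\<in>R. -1)" by (intro sum.cong) (auto simp: f_def R_def)
    then show ?thesis unfolding V(1) using V uv by (simp add: f_def)
  qed
  have wu: "w \<noteq> u" using w u(2) by auto
  have fw: "f w \<noteq> 0" using w wu by (simp add: f_def)
  have lapR: "graph_laplacian V E f a = (if {a, v} \<in> E then -1 else 0)" if "a \<in> R" for a
  proof -
    have "{u, a} \<notin> E" using that Nu by (auto simp: R_def)
    then have "{a, u} \<notin> E" by (simp add: insert_commute)
    then have "graph_laplacian V E f a = (\<Sum>b\<in>{b\<in>V. {a, b} \<in> E}. if b = v then -1 else 0)"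
      unfolding graph_laplacian_def using that by (intro sum.cong) (auto simp: f_def R_def)
    then show ?thesis using v fin by simp
  qed
  have le: "f a * graph_laplacian V E f a \<le> (f a)\<^sup>2" if a: "a \<in> V" for a
  proof -
    consider "a = u" | "a = v" | "a \<in> R" using a by (auto simp: R_def)
    then show ?thesis
    proof cases
      case 1
      then show ?thesis using uv by (simp add: graph_laplacian_def Nu f_def power2_eq_square)
    next
      case 2
      then show ?thesis using uv by (simp add: f_def)
    next
      case 3
      then show ?thesis by (auto simp: lapR f_def R_def)
    qed
  qed
  \<comment> \<open>At \<open>w\<close> the Laplacian of \<open>f\<close> is 0, as \<open>w\<close>
    is not adjacent to \<open>v\<close>, while the square of \<open>f w\<close> is 1.\<close>
  have lt: "f w * graph_laplacian V E f w < (f w)\<^sup>2"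
    using w wu by (simp add: lapR R_def f_def)
  have "algebraic_connectivity V E * (\<Sum>a\<in>V. (f a)\<^sup>2) \<le> (\<Sum>a\<in>V. f a * graph_laplacian V E f a)"
    by (rule algebraic_connectivity_le_Rayleigh[OF G two_le_card_if_sum_eq_0[OF fin w(1) fw sum] sum])
  also have "\<dots> < (\<Sum>a\<in>V. (f a)\<^sup>2)"
    using fin le lt w(1) by (intro sum_strict_mono_ex1) auto
  finally have "algebraic_connectivity V E * (\<Sum>a\<in>V. (f a)\<^sup>2) < 1 * (\<Sum>a\<in>V. (f a)\<^sup>2)" by simp
  moreover have "0 \<le> (\<Sum>a\<in>V. (f a)\<^sup>2)" by (simp add: sum_nonneg)
  ultimately show ?thesis by (rule mult_right_less_imp_less)
qed

lemma algebraic_connectivity_add_pendant_edges_le: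
  assumes G: "simple_graph V E" and G': "simple_graph V (E \<union> F)" and card: "2 \<le> card V"
    and less1: "algebraic_connectivity V E < 1"
    and S: "S \<subseteq> V" "\<forall>u\<in>S. pendant E u \<and> {u, v} \<in> E"
    and F: "F \<subseteq> {{x, y} | x y. x \<in> S \<and> y \<in> S \<and> x \<noteq> y}"
  shows "algebraic_connectivity V (E \<union> F) \<le> algebraic_connectivity V E"
proof -
  let ?\<alpha> = "algebraic_connectivity V E"
  have fin: "finite V" using G by (simp add: simple_graph_def)
  obtain f a where f: "a \<in> V" "f a \<noteq> 0" "(\<Sum>a\<in>V. f a) = 0"
    and ev: "\<forall>a\<in>V. graph_laplacian V E f a = ?\<alpha> * f a"
    using algebraic_connectivity_eigenfunction[OF G card] by blast
  \<comment> \<open>The only neighbour of \<open>u\<close> is \<open>v\<close>, so the eigenvalue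
    equation has a single difference. As the eigenvalue is below 1, it can be solved for
    \<open>f u\<close>, with a result independent of \<open>u\<close>.\<close>
  have const: "f u = f v / (1 - ?\<alpha>)" if "u \<in> S" for u
  proof -
    have "f u - f v = ?\<alpha> * f u"
      using ev S that pendant_neighbours[OF G, of u v] by (force simp: graph_laplacian_def)
    then show ?thesis using less1 by (simp add: field_simps)
  qed
  have eq: "f x = f y" if "{x, y} \<in> F" for x y
  proof -
    have "x \<in> S" "y \<in> S" using F that by (auto simp: doubleton_eq_iff)
    then show ?thesis using const by simp
  qed
  \<comment> \<open>In the quadratic form every edge of \<open>F\<close> contributes a zero square,
    so adding \<open>F\<close> changes nothing.\<close>
  have "(\<Sum>a\<in>V. f a * graph_laplacian V (E \<union> F) f a) = (\<Sum>a\<in>V. f a * graph_laplacian V E f a)"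
    unfolding sum_f_graph_laplacian[OF fin]
    by (intro arg_cong2[of _ _ _ _ "(/)"] sum.cong refl) (auto dest: eq)
  also have "\<dots> = ?\<alpha> * (\<Sum>a\<in>V. (f a)\<^sup>2)"
    unfolding sum_distrib_left using ev by (intro sum.cong) (auto simp: power2_eq_square)
  finally show ?thesis by (intro algebraic_connectivity_le[OF G' f]) simp
qed

theorem theorem3p5:
  fixes V :: "'a set" and E F :: "'a set set" and S :: "'a set" and v :: 'a
    and n k s t :: nat
  assumes "simple_graph V E" and "card V = n"
    and "1 \<le> k" and "k \<le> n - 1"
    and "S \<subseteq> V" and "card S = s" and "2 \<le> s"
    and "v \<in> V" and "vertex_degree E v \<noteq> n - 1"
    and "\<forall>u\<in>S. pendant E u \<and> {u, v} \<in> E"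
    and "F \<subseteq> {{x, y} | x y. x \<in> S \<and> y \<in> S \<and> x \<noteq> y}"
    and "card F = t" and "t \<le> s * (s - 1) div 2"
    and "algebraic_connectivity (token_verts k V) (token_edges k V E)
           = algebraic_connectivity V E"
  shows "algebraic_connectivity (token_verts k V) (token_edges k V (E \<union> F))
           = algebraic_connectivity V (E \<union> F)"
proof (rule antisym)
  have G': "simple_graph V (E \<union> F)"
    using assms(1,5,11) by (fastforce simp: simple_graph_def)
  have k: "1 \<le> k" "k \<le> card V - 1" using assms by auto
  show "algebraic_connectivity (token_verts k V) (token_edges k V (E \<union> F))
      \<le> algebraic_connectivity V (E \<union> F)"
    by (rule algebraic_connectivity_token_le(2)[OF G' k])
  obtain u where "u \<in> S" using assms(6,7) by fastforce
  then have "algebraic_connectivity V E < 1"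
    using algebraic_connectivity_less_1[OF assms(1,8)] assms(2,9,10) by blast
  then have "algebraic_connectivity V (E \<union> F) \<le> algebraic_connectivity V E"
    using algebraic_connectivity_add_pendant_edges_le[OF assms(1) G' _ _ assms(5,10,11)] k by simp
  also have "\<dots> = algebraic_connectivity (token_verts k V) (token_edges k V E)"
    using assms(14) ..
  \<comment> \<open>Enlarging the edge set of the base graph enlarges that of the token graph on the
    same vertices, so monotonicity applies there.\<close>
  also have "\<dots> \<le> algebraic_connectivity (token_verts k V) (token_edges k V (E \<union> F))"
    by (rule algebraic_connectivity_mono[OF simple_graph_token[OF G'] _ algebraic_connectivity_token_le(1)[OF G' k]])
      (auto simp: token_edges_def)
  finally show "algebraic_connectivity V (E \<union> F)
      \<le> algebraic_connectivity (token_verts k V) (token_edges k V (E \<union> F))" .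
qed

end
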